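(* Consider a network contribution game on a finite simple undirected graph $G=(V,E)$ with budgets $B_v\ge 0$ ($v\in V$) in which every reward function $f_e$ ($e\in E$) belongs to the class $\mathcal{C}_0$. Then a strong equilibrium exists and can be computed efficiently (in polynomial time).
   Context: Network contribution game: a finite simple undirected graph $G=(V,E)$; every node $v\in V$ is a player with budget $B_v\ge 0$. Let $E_v$ be the set of edges incident to $v$. A strategy of $v$ is a function $s_v:E_v\to\mathbb{R}_{\ge 0}$ with $\sum_{e\in E_v}s_v(e)\le B_v$; a state $s=(s_v)_{v\in V}$ consists of one strategy per player. Each edge $e=(u,v)$ has a reward function $f_e:\mathbb{R}_{\ge 0}^2\to\mathbb{R}_{\ge 0}$ that is nondecreasing in each argument, symmetric, continuous and differentiable. The utility of $v$ is $w_v(s)=\sum_{e=(v,u)\in E_v}f_e(s_v(e),s_u(e))$. In a state $s$, a coalition $C\subseteq V$ (nonempty) has a coalitional deviation $s'_C=(s'_v)_{v\in C}$ if $w_v(s'_C,s_{-C})>w_v(s)$ for every $v\in C$. A state is a strong equilibrium if no coalition $C\subseteq V$ has a coalitional deviation. A function $f$ is coordinate-convex if $\partial^2 f/\partial x_i^2\ge 0$ for each of its arguments $x_i$. The class $\mathcal{C}$ consists of all symmetric nondecreasing coordinate-convex functions $f:\mathbb{R}_{\ge0}\times\mathbb{R}_{\ge0}\to\mathbb{R}_{\ge0}$, and $\mathcal{C}_0$ is the subclass of those $f\in\mathcal{C}$ with $f(x,0)=0$ for all $x\ge 0$. *)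

theory Defs
  imports "HOL-Analysis.Analysis"
begin

section \<open>Reward functions\<close>

text \<open>A reward function is only meaningful on the quadrant of nonnegative arguments. It is
  represented by a total function whose values outside that quadrant are never referred to.\<close>

definition nondecreasing :: "(real \<Rightarrow> real \<Rightarrow> real) \<Rightarrow> bool" where
  "nondecreasing f \<longleftrightarrow>
     (\<forall>y\<ge>0. mono_on {0..} (\<lambda>x. f x y) \<and> mono_on {0..} (\<lambda>x. f y x))"

definition symmetric :: "(real \<Rightarrow> real \<Rightarrow> real) \<Rightarrow> bool" where
  "symmetric f \<longleftrightarrow> (\<forall>x\<ge>0. \<forall>y\<ge>0. f x y = f y x)"

definition nonnegative :: "(real \<Rightarrow> real \<Rightarrow> real) \<Rightarrow> bool" where
  "nonnegative f \<longleftrightarrow> (\<forall>x\<ge>0. \<forall>y\<ge>0. 0 \<le> f x y)"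

definition reward_function :: "(real \<Rightarrow> real \<Rightarrow> real) \<Rightarrow> bool" where
  "reward_function f \<longleftrightarrow> nonnegative f \<and> nondecreasing f \<and> symmetric f \<and>
     continuous_on ({0..} \<times> {0..}) (\<lambda>(x, y). f x y) \<and>
     (\<lambda>(x, y). f x y) differentiable_on ({0..} \<times> {0..})"

definition nonneg_second_derivative_at :: "(real \<Rightarrow> real) \<Rightarrow> real \<Rightarrow> bool" where
  "nonneg_second_derivative_at g x \<longleftrightarrow>
     g differentiable at x \<and> deriv g differentiable at x \<and> 0 \<le> deriv (deriv g) x"

text \<open>The second partial derivative in an argument is required where that argument is positive.
  At 0 it would have to be one-sided, and it need not exist there: consider
  \<open>x powr (3/2) * y powr (3/2)\<close>.\<close>

definition coordinate_convex :: "(real \<Rightarrow> real \<Rightarrow> real) \<Rightarrow> bool" where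
  "coordinate_convex f \<longleftrightarrow> (\<forall>x>0. \<forall>y\<ge>0.
     nonneg_second_derivative_at (\<lambda>t. f t y) x \<and> nonneg_second_derivative_at (\<lambda>t. f y t) x)"

definition class_C :: "(real \<Rightarrow> real \<Rightarrow> real) set" where
  "class_C = {f. nonnegative f \<and> symmetric f \<and> nondecreasing f \<and> coordinate_convex f}"

definition class_C0 :: "(real \<Rightarrow> real \<Rightarrow> real) set" where
  "class_C0 = {f \<in> class_C. \<forall>x\<ge>0. f x 0 = 0}"

section \<open>Network contribution games\<close>

record 'v game =
  nodes :: "'v set"
  edges :: "'v set set"
  budget :: "'v \<Rightarrow> real"
  reward :: "'v set \<Rightarrow> real \<Rightarrow> real \<Rightarrow> real"

definition contribution_game :: "'v game \<Rightarrow> bool" where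
  "contribution_game G \<longleftrightarrow>
     finite (nodes G) \<and>
     (\<forall>e\<in>edges G. e \<subseteq> nodes G \<and> card e = 2) \<and>
     (\<forall>v\<in>nodes G. 0 \<le> budget G v) \<and>
     (\<forall>e\<in>edges G. reward_function (reward G e))"

definition incident :: "'v game \<Rightarrow> 'v \<Rightarrow> 'v set set" where
  "incident G v = {e \<in> edges G. v \<in> e}"

text \<open>Strategies are total functions; their values outside \<open>incident G v\<close> are immaterial.\<close>

definition strategy :: "'v game \<Rightarrow> 'v \<Rightarrow> ('v set \<Rightarrow> real) \<Rightarrow> bool" where
  "strategy G v \<sigma> \<longleftrightarrow>
     (\<forall>e\<in>incident G v. 0 \<le> \<sigma> e) \<and> (\<Sum>e\<in>incident G v. \<sigma> e) \<le> budget G v"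

type_synonym 'v profile = "'v \<Rightarrow> 'v set \<Rightarrow> real"

definition game_state :: "'v game \<Rightarrow> 'v profile \<Rightarrow> bool" where
  "game_state G s \<longleftrightarrow> (\<forall>v\<in>nodes G. strategy G v (s v))"

definition utility :: "'v game \<Rightarrow> 'v profile \<Rightarrow> 'v \<Rightarrow> real" where
  "utility G s v = (\<Sum>u | {v, u} \<in> edges G. reward G {v, u} (s v {v, u}) (s u {v, u}))"

definition coalitional_deviation ::
  "'v game \<Rightarrow> 'v profile \<Rightarrow> 'v set \<Rightarrow> 'v profile \<Rightarrow> bool" where
  "coalitional_deviation G s C s' \<longleftrightarrow>
     (\<forall>v\<in>C. strategy G v (s' v)) \<and>
     (\<forall>v\<in>C. utility G (override_on s s' C) v > utility G s v)"

definition strong_equilibrium :: "'v game \<Rightarrow> 'v profile \<Rightarrow> bool" where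
  "strong_equilibrium G s \<longleftrightarrow> game_state G s \<and>
     \<not> (\<exists>C s'. C \<subseteq> nodes G \<and> C \<noteq> {} \<and> coalitional_deviation G s C s')"

section \<open>A random access machine with real registers and value queries\<close>

text \<open>Budgets and rewards are real numbers and the reward functions are arbitrary, so running time
  is measured on a random access machine that holds natural numbers and (exact) real numbers and
  that can query the value of a reward function. The machine is programmed in a while language.
  Every operation, memory access, comparison and query has unit cost. Multiplication is left out
  on purpose: arithmetic then lengthens numbers by at most one bit per step, so that unit cost does
  not hide exponential work. There is no rounding of reals to natural numbers either, nor are
  there real constants other than those obtained from natural numbers.\<close>

record store =
  nreg :: "nat \<Rightarrow> nat"
  rreg :: "nat \<Rightarrow> real"
  nmem :: "nat \<Rightarrow> nat"
  rmem :: "nat \<Rightarrow> real"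

datatype nexp =
    NConst nat
  | NReg nat
  | NMem nexp
  | NAdd nexp nexp
  | NSub nexp nexp

datatype rexp =
    OfNat nexp
  | RReg nat
  | RMem nexp
  | RAdd rexp rexp
  | RSub rexp rexp
  | Query nexp rexp rexp

datatype bexp =
    NLess nexp nexp
  | RLess rexp rexp
  | BNot bexp
  | BAnd bexp bexp

datatype com =
    Skip
  | SetN nat nexp
  | SetR nat rexp
  | StoreN nexp nexp
  | StoreR nexp rexp
  | Seq com com
  | Cond bexp com com
  | While bexp com

text \<open>In \<open>Query\<close>, the first argument is the index of the function to be evaluated.\<close>

type_synonym value_oracle = "nat \<Rightarrow> real \<Rightarrow> real \<Rightarrow> real"

primrec nval :: "nexp \<Rightarrow> store \<Rightarrow> nat" where
  "nval (NConst c) M = c"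
| "nval (NReg i) M = nreg M i"
| "nval (NMem a) M = nmem M (nval a M)"
| "nval (NAdd a b) M = nval a M + nval b M"
| "nval (NSub a b) M = nval a M - nval b M"

primrec rval :: "value_oracle \<Rightarrow> rexp \<Rightarrow> store \<Rightarrow> real" where
  "rval q (OfNat a) M = real (nval a M)"
| "rval q (RReg i) M = rreg M i"
| "rval q (RMem a) M = rmem M (nval a M)"
| "rval q (RAdd a b) M = rval q a M + rval q b M"
| "rval q (RSub a b) M = rval q a M - rval q b M"
| "rval q (Query k a b) M = q (nval k M) (rval q a M) (rval q b M)"

primrec bval :: "value_oracle \<Rightarrow> bexp \<Rightarrow> store \<Rightarrow> bool" where
  "bval q (NLess a b) M \<longleftrightarrow> nval a M < nval b M"
| "bval q (RLess a b) M \<longleftrightarrow> rval q a M < rval q b M"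
| "bval q (BNot b) M \<longleftrightarrow> \<not> bval q b M"
| "bval q (BAnd b c) M \<longleftrightarrow> bval q b M \<and> bval q c M"

primrec ncost :: "nexp \<Rightarrow> nat" where
  "ncost (NConst c) = 1"
| "ncost (NReg i) = 1"
| "ncost (NMem a) = 1 + ncost a"
| "ncost (NAdd a b) = 1 + ncost a + ncost b"
| "ncost (NSub a b) = 1 + ncost a + ncost b"

primrec rcost :: "rexp \<Rightarrow> nat" where
  "rcost (OfNat a) = 1 + ncost a"
| "rcost (RReg i) = 1"
| "rcost (RMem a) = 1 + ncost a"
| "rcost (RAdd a b) = 1 + rcost a + rcost b"
| "rcost (RSub a b) = 1 + rcost a + rcost b"
| "rcost (Query k a b) = 1 + ncost k + rcost a + rcost b"

primrec bcost :: "bexp \<Rightarrow> nat" where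
  "bcost (NLess a b) = 1 + ncost a + ncost b"
| "bcost (RLess a b) = 1 + rcost a + rcost b"
| "bcost (BNot b) = 1 + bcost b"
| "bcost (BAnd b c) = 1 + bcost b + bcost c"

text \<open>\<open>exec q c M t M'\<close>: started in store \<open>M\<close>, program \<open>c\<close> halts after \<open>t\<close> steps in
  store \<open>M'\<close>.\<close>

inductive exec :: "value_oracle \<Rightarrow> com \<Rightarrow> store \<Rightarrow> nat \<Rightarrow> store \<Rightarrow> bool" for q where
  Skip: "exec q Skip M 1 M"
| SetN: "exec q (SetN i a) M (1 + ncost a) (M\<lparr>nreg := (nreg M)(i := nval a M)\<rparr>)"
| SetR: "exec q (SetR i a) M (1 + rcost a) (M\<lparr>rreg := (rreg M)(i := rval q a M)\<rparr>)"
| StoreN: "exec q (StoreN a b) M (1 + ncost a + ncost b)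
             (M\<lparr>nmem := (nmem M)(nval a M := nval b M)\<rparr>)"
| StoreR: "exec q (StoreR a b) M (1 + ncost a + rcost b)
             (M\<lparr>rmem := (rmem M)(nval a M := rval q b M)\<rparr>)"
| Seq: "exec q c M t M' \<Longrightarrow> exec q d M' t' M'' \<Longrightarrow> exec q (Seq c d) M (t + t') M''"
| CondTrue: "bval q b M \<Longrightarrow> exec q c M t M' \<Longrightarrow> exec q (Cond b c d) M (1 + bcost b + t) M'"
| CondFalse: "\<not> bval q b M \<Longrightarrow> exec q d M t M' \<Longrightarrow> exec q (Cond b c d) M (1 + bcost b + t) M'"
| WhileFalse: "\<not> bval q b M \<Longrightarrow> exec q (While b c) M (1 + bcost b) M"
| WhileTrue: "bval q b M \<Longrightarrow> exec q c M t M' \<Longrightarrow> exec q (While b c) M' t' M'' \<Longrightarrow>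
                exec q (While b c) M (1 + bcost b + t + t') M''"

section \<open>Games as machine input, states as machine output\<close>

text \<open>A game is presented by an enumeration of its nodes and a list of its edges, each edge
  occurring once, as a pair of positions in the enumeration of the nodes.\<close>

definition edge_at :: "'v list \<Rightarrow> (nat \<times> nat) list \<Rightarrow> nat \<Rightarrow> 'v set" where
  "edge_at vs ps k = {vs ! fst (ps ! k), vs ! snd (ps ! k)}"

definition presents :: "'v list \<Rightarrow> (nat \<times> nat) list \<Rightarrow> 'v game \<Rightarrow> bool" where
  "presents vs ps G \<longleftrightarrow>
     distinct vs \<and> set vs = nodes G \<and>
     (\<forall>(i, j)\<in>set ps. i < length vs \<and> j < length vs) \<and>
     bij_betw (edge_at vs ps) {..<length ps} (edges G)"

definition reward_oracle :: "'v list \<Rightarrow> (nat \<times> nat) list \<Rightarrow> 'v game \<Rightarrow> value_oracle" where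
  "reward_oracle vs ps G k x y =
     (if k < length ps \<and> 0 \<le> x \<and> 0 \<le> y then reward G (edge_at vs ps k) x y else 0)"

text \<open>Natural number registers 0 and 1 hold the numbers of nodes and of edges. Cells \<open>2 * k\<close> and
  \<open>2 * k + 1\<close> of the natural number memory hold the two end points of edge \<open>k\<close>. The budget of
  node \<open>i\<close> is in cell \<open>i\<close> of the real memory. Everything else is 0.\<close>

definition input_store :: "'v list \<Rightarrow> (nat \<times> nat) list \<Rightarrow> 'v game \<Rightarrow> store" where
  "input_store vs ps G =
    \<lparr>nreg = (\<lambda>_. 0)(0 := length vs, 1 := length ps),
     rreg = (\<lambda>_. 0),
     nmem = (\<lambda>a. if a < 2 * length ps
                 then (if even a then fst else snd) (ps ! (a div 2)) else 0),
     rmem = (\<lambda>a. if a < length vs then budget G (vs ! a) else 0)\<rparr>"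

text \<open>The output is read from the real memory behind the budgets: for each edge, in the order of
  the list, the contribution of its first and then that of its second end point.\<close>

definition outputs :: "'v list \<Rightarrow> (nat \<times> nat) list \<Rightarrow> store \<Rightarrow> 'v profile \<Rightarrow> bool" where
  "outputs vs ps M s \<longleftrightarrow> (\<forall>k<length ps.
     s (vs ! fst (ps ! k)) (edge_at vs ps k) = rmem M (length vs + 2 * k) \<and>
     s (vs ! snd (ps ! k)) (edge_at vs ps k) = rmem M (length vs + 2 * k + 1))"

end

theory Submission
  imports Defs
begin

text \<open>By coordinate-convexity and \<open>f 0 y = 0\<close>, a reward satisfies the chord bound
  \<open>f x y \<le> x / B * f B y\<close>, so no player earns more than the best single edge
  offers against full budgets. Process edges greedily: repeatedly choose an edge of maximal reward
  with respect to the residual budgets and let both end points spend all they have left on it. In a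
  deviating coalition, consider the first edge chosen that meets it, and a member \<open>v\<close> on that
  edge. Neighbours of \<open>v\<close> that were served earlier are outside the coalition and contribute
  nothing to their edges with \<open>v\<close>; with all other neighbours the greedy choice bounds what
  \<open>v\<close> can earn by what it has.\<close>

section \<open>Rewards\<close>

lemma class_C0_nonneg:
  assumes "f \<in> class_C0" "0 \<le> x" "0 \<le> y"
  shows "0 \<le> f x y"
  using assms by (auto simp: class_C0_def class_C_def nonnegative_def)

lemma class_C0_symmetric:
  assumes "f \<in> class_C0" "0 \<le> x" "0 \<le> y"
  shows "f x y = f y x"
  using assms by (auto simp: class_C0_def class_C_def symmetric_def)

lemma class_C0_zero:
  assumes "f \<in> class_C0" "0 \<le> x"
  shows "f x 0 = 0" "f 0 x = 0"
  using assms class_C0_symmetric[of f x 0] by (auto simp: class_C0_def)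

lemma class_C0_mono:
  assumes "f \<in> class_C0" "0 \<le> x" "0 \<le> y" "y \<le> z"
  shows "f x y \<le> f x z"
  using assms by (auto simp: class_C0_def class_C_def nondecreasing_def mono_on_def)

text \<open>\<open>f\<close> is convex in its first argument and vanishes where that argument is 0.
  Derivatives are available for positive arguments only, so the chord starts at some
  \<open>t > 0\<close>, and continuity lets \<open>t\<close> tend to 0. The product form covers
  \<open>b = 0\<close> as well.\<close>

lemma class_C0_chord:
  assumes f: "f \<in> class_C0" "reward_function f" and x: "0 \<le> x" "x \<le> b" and y: "0 \<le> y"
  shows "f x y * b \<le> x * f b y"
proof (cases "x = 0 \<or> x = b")
  case True
  then show ?thesis using class_C0_zero(2)[OF f(1) y] by auto
next
  case False
  with x have x: "0 < x" "x < b" by auto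
  define g where "g t = f t y" for t
  have d: "nonneg_second_derivative_at g t" if "t > 0" for t
    using that y f(1) by (auto simp: class_C0_def class_C_def coordinate_convex_def g_def[abs_def])
  have cvx: "convex_on {0<..} g"
  proof (rule f''_ge0_imp_convex)
    show "convex {0::real<..}" by (rule convex_real_interval)
    fix t :: real assume "t \<in> {0<..}"
    then have "nonneg_second_derivative_at g t" using d by simp
    then show "(g has_real_derivative deriv g t) (at t)"
      and "(deriv g has_real_derivative deriv (deriv g) t) (at t)" and "0 \<le> deriv (deriv g) t"
      by (auto simp: nonneg_second_derivative_at_def DERIV_deriv_iff_real_differentiable)
  qed
  have chord: "(b - t) * g x \<le> (b - x) * g t + (x - t) * g b" if "0 < t" "t < x" for t
  proof -
    \<comment> \<open>The weight with which \<open>x\<close> is the convex combination of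
      \<open>t\<close> and \<open>b\<close>.\<close>
    define l where "l = (x - t) / (b - t)"
    have l: "0 \<le> l" "l \<le> 1" "l * (b - t) = x - t"
      using that x by (simp_all add: l_def)
    have point: "(1 - l) *\<^sub>R t + l *\<^sub>R b = t + l * (b - t)"
      by (simp add: algebra_simps)
    have "g ((1 - l) *\<^sub>R t + l *\<^sub>R b) \<le> (1 - l) * g t + l * g b"
      using that x l by (intro convex_onD[OF cvx]) auto
    then have "g x \<le> (1 - l) * g t + l * g b"
      unfolding point l(3) by simp
    then have "(b - t) * g x \<le> (b - t) * ((1 - l) * g t + l * g b)"
      using that x by (intro mult_left_mono) auto
    also have "\<dots> = ((b - t) - l * (b - t)) * g t + l * (b - t) * g b"
      by (simp add: algebra_simps)
    finally show ?thesis unfolding l(3) by simp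
  qed
  have "continuous_on ({0..} \<times> {0..}) (\<lambda>(x, y). f x y)"
    using f(2) by (simp add: reward_function_def)
  moreover have "continuous_on {0..} (\<lambda>t. (t, y))"
    by (intro continuous_on_Pair continuous_on_id continuous_on_const)
  ultimately have "continuous_on {0..} (\<lambda>t. case (t, y) of (x, y) \<Rightarrow> f x y)"
    by (rule continuous_on_compose2) (use y in auto)
  then have "continuous_on {0..} g" by (simp add: g_def[abs_def])
  then have "(g \<longlongrightarrow> g 0) (at 0 within {0..})"
    by (simp add: continuous_on)
  then have g0: "(g \<longlongrightarrow> g 0) (at_right 0)"
    by (rule tendsto_within_subset) auto
  \<comment> \<open>The limit of \<open>chord\<close> as \<open>t\<close> tends to 0 from the right;
    the zeros are kept so that the limit has the same shape.\<close>
  have "(b - 0) * g x \<le> (b - x) * g 0 + (x - 0) * g b"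
  proof (rule tendsto_le)
    show "\<forall>\<^sub>F t in at_right 0. (b - t) * g x \<le> (b - x) * g t + (x - t) * g b"
      using eventually_at_right_less[of 0] eventually_at_right_real[OF x(1)]
      by eventually_elim (use chord in auto)
    show "((\<lambda>t. (b - t) * g x) \<longlongrightarrow> (b - 0) * g x) (at_right 0)"
      and "((\<lambda>t. (b - x) * g t + (x - t) * g b)
        \<longlongrightarrow> (b - x) * g 0 + (x - 0) * g b) (at_right 0)"
      by (intro tendsto_intros g0)+
  qed simp
  then show ?thesis using class_C0_zero(2)[OF f(1) y] by (simp add: g_def mult.commute)
qed

section \<open>Greedy allocations\<close>

text \<open>Lists of chosen edges have the most recent choice first.\<close>

definition residual :: "'v game \<Rightarrow> 'v set list \<Rightarrow> 'v \<Rightarrow> real" where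
  "residual G es v = (if v \<in> \<Union>(set es) then 0 else budget G v)"

text \<open>Contributions accumulate because an edge may be chosen again; its ends then have
  residual 0 and nothing is added.\<close>

primrec allot :: "'v game \<Rightarrow> 'v set list \<Rightarrow> 'v profile" where
  "allot G [] v a = 0"
| "allot G (e # es) v a = allot G es v a + (if v \<in> e \<and> a = e then residual G es v else 0)"

text \<open>Edges are sets, hence the quantification over both orders of the ends. Repeated choices
  are allowed, so a nonempty edge set always admits another choice and the number of rounds can be
  fixed in advance.\<close>

primrec greedy :: "'v game \<Rightarrow> 'v set list \<Rightarrow> bool" where
  "greedy G [] \<longleftrightarrow> True"
| "greedy G (e # es) \<longleftrightarrow> greedy G es \<and> e \<in> edges G \<and>
     (\<forall>x y u v. e = {x, y} \<longrightarrow> {u, v} \<in> edges G \<longrightarrow>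
        reward G {u, v} (residual G es u) (residual G es v)
          \<le> reward G e (residual G es x) (residual G es y))"

lemma greedy_subset: "greedy G es \<Longrightarrow> set es \<subseteq> edges G"
  by (induction es) auto

lemma greedy_appendD: "greedy G (ys @ zs) \<Longrightarrow> greedy G zs"
  by (induction ys) auto

lemma allot_unserved: "v \<notin> \<Union>(set es) \<Longrightarrow> allot G es v a = 0"
  by (induction es) auto

lemma allot_unchosen: "a \<notin> set es \<Longrightarrow> allot G es v a = 0"
  by (induction es) auto

text \<open>After \<open>v\<close> has been served its residual is 0, so the later choices
  \<open>ys\<close> add nothing.\<close>

lemma allot_append: "v \<in> \<Union>(set zs) \<Longrightarrow> allot G (ys @ zs) v a = allot G zs v a"
  by (induction ys) (auto simp: residual_def)

lemma allot_served:
  assumes "v \<in> e" "v \<notin> \<Union>(set zs)"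
  shows "allot G (ys @ e # zs) v e = budget G v"
proof -
  have "allot G (ys @ e # zs) v e = allot G (e # zs) v e"
    by (rule allot_append) (use assms in auto)
  then show ?thesis using assms allot_unserved[OF assms(2)] by (simp add: residual_def)
qed

text \<open>All that \<open>u\<close> has went to edges in \<open>zs\<close>, and \<open>a\<close>
  is not one of them since it contains the unserved \<open>v\<close>.\<close>

lemma allot_earlier:
  assumes "u \<in> \<Union>(set zs)" "v \<notin> \<Union>(set zs)" "v \<in> a"
  shows "allot G (ys @ zs) u a = 0"
proof -
  have "a \<notin> set zs" using assms by auto
  then show ?thesis using assms(1) by (simp add: allot_append allot_unchosen)
qed

locale class_C0_game =
  fixes G :: "'v game"
  assumes game: "contribution_game G"
    and rewards: "\<forall>e\<in>edges G. reward G e \<in> class_C0"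
begin

section \<open>Edges, neighbours and strategies\<close>

lemma budget_nonneg: "v \<in> nodes G \<Longrightarrow> 0 \<le> budget G v"
  using game by (simp add: contribution_game_def)

lemma edge_nodes: "{u, v} \<in> edges G \<Longrightarrow> u \<in> nodes G \<and> v \<in> nodes G \<and> u \<noteq> v"
  using game unfolding contribution_game_def by (auto dest!: bspec[of "edges G" _ "{u, v}"])

lemma edgeE:
  assumes "e \<in> edges G" "v \<in> e"
  obtains x where "e = {v, x}"
proof -
  have "card e = 2" using assms game by (simp add: contribution_game_def)
  with that assms(2) show thesis by (auto simp: card_2_iff insert_commute)
qed

lemma finite_edges: "finite (edges G)"
proof -
  have "edges G \<subseteq> Pow (nodes G)" "finite (nodes G)"
    using game by (auto simp: contribution_game_def)
  then show ?thesis using finite_subset by blast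
qed

lemma finite_neighbours: "finite {u. {v, u} \<in> edges G}"
proof (rule finite_subset)
  show "{u. {v, u} \<in> edges G} \<subseteq> nodes G" using edge_nodes by blast
  show "finite (nodes G)" using game by (simp add: contribution_game_def)
qed

lemma incident_image: "incident G v = (\<lambda>u. {v, u}) ` {u. {v, u} \<in> edges G}"
proof
  show "incident G v \<subseteq> (\<lambda>u. {v, u}) ` {u. {v, u} \<in> edges G}"
  proof
    fix e assume "e \<in> incident G v"
    then have e: "e \<in> edges G" "v \<in> e" by (auto simp: incident_def)
    then obtain x where "e = {v, x}" by (rule edgeE)
    with e show "e \<in> (\<lambda>u. {v, u}) ` {u. {v, u} \<in> edges G}" by auto
  qed
qed (auto simp: incident_def)

lemma finite_incident: "finite (incident G v)"
  using finite_edges by (simp add: incident_def)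

text \<open>Budgets limit sums over edges while utilities are sums over neighbours; this makes the
  two comparable.\<close>

lemma sum_incident: "(\<Sum>e\<in>incident G v. \<sigma> e) = (\<Sum>u | {v, u} \<in> edges G. \<sigma> {v, u})"
  unfolding incident_image
  by (subst sum.reindex) (auto simp: inj_on_def doubleton_eq_iff)

lemma strategyD:
  assumes "strategy G v \<sigma>" "{v, u} \<in> edges G"
  shows "0 \<le> \<sigma> {v, u}" "\<sigma> {v, u} \<le> budget G v"
proof -
  have e: "{v, u} \<in> incident G v" using assms(2) by (simp add: incident_def)
  then show "0 \<le> \<sigma> {v, u}" using assms(1) by (auto simp: strategy_def)
  have "\<sigma> {v, u} \<le> (\<Sum>e\<in>incident G v. \<sigma> e)"
    using e assms(1) by (intro member_le_sum) (auto simp: strategy_def finite_incident)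
  then show "\<sigma> {v, u} \<le> budget G v" using assms(1) by (auto simp: strategy_def)
qed

lemma game_state_override:
  assumes "game_state G s" "\<forall>v\<in>C. strategy G v (s' v)"
  shows "game_state G (override_on s s' C)"
  using assms by (auto simp: game_state_def override_on_def)

section \<open>Bounds on utilities\<close>

lemma reward_nonneg:
  assumes "game_state G s" "{v, u} \<in> edges G"
  shows "0 \<le> reward G {v, u} (s v {v, u}) (s u {v, u})"
proof -
  have "strategy G v (s v)" "strategy G u (s u)"
    using assms edge_nodes[of v u] by (auto simp: game_state_def)
  then have "0 \<le> s v {v, u}" "0 \<le> s u {v, u}"
    using strategyD(1)[of v "s v" u] strategyD(1)[of u "s u" v] assms(2)
    by (auto simp: insert_commute)
  then show ?thesis using rewards assms(2) class_C0_nonneg by blast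
qed

lemma utility_ge:
  assumes "game_state G s" "{v, u} \<in> edges G"
  shows "reward G {v, u} (s v {v, u}) (s u {v, u}) \<le> utility G s v"
  unfolding utility_def
  by (rule member_le_sum[of u _ "\<lambda>u. reward G {v, u} (s v {v, u}) (s u {v, u})"])
     (use assms reward_nonneg finite_neighbours in auto)

lemma utility_nonneg: "game_state G s \<Longrightarrow> 0 \<le> utility G s v"
  unfolding utility_def by (rule sum_nonneg) (use reward_nonneg in auto)

text \<open>By the chord bound an edge yields at most the fraction of the budget spent on it times
  \<open>W\<close>, and these fractions sum to at most 1. Neighbours that contribute 0 are exempt,
  which is what the deviation argument needs for players served before the coalition.\<close>

lemma utility_le:
  assumes s: "game_state G s" and v: "v \<in> nodes G" and "0 \<le> W"
    and W: "\<And>u. {v, u} \<in> edges G \<Longrightarrow>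
      s u {v, u} = 0 \<or> reward G {v, u} (budget G v) (budget G u) \<le> W"
  shows "utility G s v \<le> W"
proof -
  have sv: "strategy G v (s v)" using s v by (simp add: game_state_def)
  let ?B = "budget G v"
  have le: "reward G {v, u} (s v {v, u}) (s u {v, u}) * ?B \<le> s v {v, u} * W"
    if e: "{v, u} \<in> edges G" for u
  proof -
    have f: "reward G {v, u} \<in> class_C0" "reward_function (reward G {v, u})"
      using e rewards game by (auto simp: contribution_game_def)
    have u: "strategy G u (s u)" "0 \<le> budget G u"
      using e edge_nodes[of v u] s budget_nonneg by (auto simp: game_state_def)
    have x: "0 \<le> s v {v, u}" "s v {v, u} \<le> ?B" using strategyD[OF sv e] by auto
    have y: "0 \<le> s u {v, u}" "s u {v, u} \<le> budget G u"
      using strategyD[OF u(1), of v] e by (auto simp: insert_commute)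
    show ?thesis
    proof (cases "s u {v, u} = 0")
      case True
      then show ?thesis using class_C0_zero(1)[OF f(1) x(1)] x \<open>0 \<le> W\<close> by simp
    next
      case False
      \<comment> \<open>First the neighbour is raised to its full budget by monotonicity, then the
        chord bound is applied in the argument of \<open>v\<close>.\<close>
      have "reward G {v, u} (s v {v, u}) (s u {v, u}) * ?B
          \<le> reward G {v, u} (s v {v, u}) (budget G u) * ?B"
        using class_C0_mono[OF f(1) x(1) y] x by (intro mult_right_mono) auto
      also have "\<dots> \<le> s v {v, u} * reward G {v, u} ?B (budget G u)"
        by (rule class_C0_chord[OF f x u(2)])
      also have "\<dots> \<le> s v {v, u} * W"
        using W[OF e] False x by (intro mult_left_mono) auto
      finally show ?thesis .
    qed
  qed
  show ?thesis
  proof (cases "?B = 0")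
    \<comment> \<open>Here the bounds \<open>le\<close> multiplied by the budget are void, but
      \<open>v\<close> contributes 0 everywhere and so earns 0.\<close>
    case True
    have "reward G {v, u} (s v {v, u}) (s u {v, u}) = 0" if e: "{v, u} \<in> edges G" for u
    proof -
      have "s v {v, u} = 0" using strategyD[OF sv e] True by simp
      moreover have "0 \<le> s u {v, u}"
        using strategyD(1)[of u "s u" v] e edge_nodes[OF e] s
        by (auto simp: insert_commute game_state_def)
      ultimately show ?thesis using e rewards class_C0_zero(2) by auto
    qed
    then show ?thesis using \<open>0 \<le> W\<close> by (simp add: utility_def)
  next
    case False
    then have B: "0 < ?B" using budget_nonneg[OF v] by simp
    have "utility G s v * ?B \<le> (\<Sum>u | {v, u} \<in> edges G. s v {v, u} * W)"
      unfolding utility_def sum_distrib_right by (rule sum_mono) (use le in auto)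
    also have "\<dots> = (\<Sum>e\<in>incident G v. s v e) * W"
      by (simp add: sum_incident sum_distrib_right)
    also have "\<dots> \<le> ?B * W"
      using sv \<open>0 \<le> W\<close> by (intro mult_right_mono) (auto simp: strategy_def)
    finally show ?thesis using B by (simp add: mult.commute)
  qed
qed

section \<open>Greedy allocations as states of the game\<close>

lemma residual_nonneg: "v \<in> nodes G \<Longrightarrow> 0 \<le> residual G es v"
  using budget_nonneg by (simp add: residual_def)

lemma allot_nonneg: "v \<in> nodes G \<Longrightarrow> 0 \<le> allot G es v a"
  by (induction es) (auto simp: residual_nonneg)

text \<open>Each choice moves the whole residual of its ends onto an edge incident with them, so
  spent and residual amounts always add up to the budget.\<close>

lemma sum_allot:
  assumes "set es \<subseteq> edges G"
  shows "(\<Sum>a\<in>incident G v. allot G es v a) = budget G v - residual G es v"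
  using assms
proof (induction es)
  case (Cons e es)
  have "(\<Sum>a\<in>incident G v. if v \<in> e \<and> a = e then residual G es v else 0)
      = (if v \<in> e then residual G es v else 0)"
    using Cons.prems sum.delta[OF finite_incident[of v], of e "\<lambda>_. residual G es v"]
    by (auto simp: incident_def)
  then show ?case using Cons by (auto simp: sum.distrib residual_def)
qed (simp add: residual_def)

lemma allot_game_state:
  assumes "greedy G es"
  shows "game_state G (allot G es)"
  using allot_nonneg sum_allot[OF greedy_subset[OF assms]] residual_nonneg
  by (auto simp: game_state_def strategy_def)

text \<open>A served end has residual 0, and rewards vanish as soon as one argument is 0.\<close>

lemma residual_reward_pos:
  assumes "{x, y} \<in> edges G"
    and "0 < reward G {x, y} (residual G es x) (residual G es y)"
  shows "x \<notin> \<Union>(set es)" "y \<notin> \<Union>(set es)"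
proof -
  have f: "reward G {x, y} \<in> class_C0" using rewards assms(1) by blast
  have "0 \<le> residual G es x" "0 \<le> residual G es y"
    using edge_nodes[OF assms(1)] residual_nonneg by auto
  then have "residual G es x \<noteq> 0" "residual G es y \<noteq> 0"
    using assms(2) class_C0_zero[OF f] by (metis order_less_irrefl)+
  then show "x \<notin> \<Union>(set es)" "y \<notin> \<Union>(set es)" by (auto simp: residual_def split: if_splits)
qed

text \<open>As long as \<open>u\<close> and \<open>v\<close> are unserved, their edge competes with
  positive reward. Every choice then has positive reward, so its ends were unserved before and the
  edge is new.\<close>

lemma greedy_distinct:
  assumes "greedy G es" and e: "{u, v} \<in> edges G"
    and uv: "u \<notin> \<Union>(set es)" "v \<notin> \<Union>(set es)"
    and pos: "0 < reward G {u, v} (budget G u) (budget G v)"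
  shows "distinct es"
  using assms(1) uv
proof (induction es)
  case (Cons a es)
  then have a: "a \<in> edges G" "greedy G es" by auto
  then have "card a = 2" using game by (simp add: contribution_game_def)
  then obtain x y where xy: "a = {x, y}" by (auto simp: card_2_iff)
  have "0 < reward G {u, v} (residual G es u) (residual G es v)"
    using Cons.prems pos by (auto simp: residual_def)
  also have "\<dots> \<le> reward G a (residual G es x) (residual G es y)"
    using Cons.prems(1) xy e by simp
  finally have "x \<notin> \<Union>(set es)" using a xy residual_reward_pos(1) by blast
  then have "a \<notin> set es" using xy by auto
  then show ?case using Cons by auto
qed simp

text \<open>This explains the number of rounds: were the reward positive, the choices would be
  distinct, hence would be all edges and include \<open>{u, v}\<close>. It handles players that are
  never served.\<close>

lemma greedy_exhausted:
  assumes "greedy G es" "length es = card (edges G)" and e: "{u, v} \<in> edges G"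
    and uv: "u \<notin> \<Union>(set es)" "v \<notin> \<Union>(set es)"
  shows "reward G {u, v} (budget G u) (budget G v) \<le> 0"
proof (rule ccontr)
  assume "\<not> ?thesis"
  then have "distinct es" using greedy_distinct[OF assms(1) e uv] by simp
  then have "card (set es) = card (edges G)" using assms(2) distinct_card by metis
  then have "set es = edges G"
    by (intro card_subset_eq finite_edges greedy_subset assms(1))
  then show False using e uv by auto
qed

text \<open>When \<open>e\<close> was chosen, \<open>v\<close> and \<open>u\<close> still had full
  budgets, so \<open>{v, u}\<close> was a competitor. If the reward of \<open>e\<close> was
  positive, its other end was unserved too and \<open>v\<close> really earns that reward; otherwise
  nonnegativity of the utility suffices.\<close>

lemma greedy_utility_ge:
  assumes greedy: "greedy G (ys @ e # zs)" and v: "v \<in> e" "v \<notin> \<Union>(set zs)"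
    and e: "{v, u} \<in> edges G" and u: "u \<notin> \<Union>(set zs)"
  shows "reward G {v, u} (budget G v) (budget G u) \<le> utility G (allot G (ys @ e # zs)) v"
proof -
  let ?s = "allot G (ys @ e # zs)"
  have st: "game_state G ?s" by (rule allot_game_state[OF greedy])
  have g: "greedy G (e # zs)" using greedy by (rule greedy_appendD)
  then have "e \<in> edges G" by simp
  then obtain x where x: "e = {v, x}" using v(1) by (rule edgeE)
  have "reward G {v, u} (budget G v) (budget G u)
      = reward G {v, u} (residual G zs v) (residual G zs u)"
    using u v by (simp add: residual_def)
  also have "\<dots> \<le> reward G e (residual G zs v) (residual G zs x)"
    using g x e by simp
  also have "\<dots> \<le> utility G ?s v"
  proof (cases "0 < reward G e (residual G zs v) (residual G zs x)")
    case True
    then have "x \<notin> \<Union>(set zs)" using residual_reward_pos(2) \<open>e \<in> edges G\<close> x by blast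
    then have "?s v e = residual G zs v" "?s x e = residual G zs x"
      using v x allot_served[of v e zs] allot_served[of x e zs] by (auto simp: residual_def)
    then show ?thesis using utility_ge[OF st, of v x] x \<open>e \<in> edges G\<close> by auto
  next
    case False
    then show ?thesis using utility_nonneg[OF st, of v] by linarith
  qed
  finally show ?thesis .
qed

theorem greedy_strong_equilibrium:
  assumes greedy: "greedy G es" and len: "length es = card (edges G)"
  shows "strong_equilibrium G (allot G es)"
proof -
  let ?s = "allot G es"
  have st: "game_state G ?s" by (rule allot_game_state[OF greedy])
  have "\<not> coalitional_deviation G ?s C s'" if C: "C \<subseteq> nodes G" "C \<noteq> {}" for C s'
  proof
    assume dev: "coalitional_deviation G ?s C s'"
    \<comment> \<open>\<open>zs\<close> holds the choices made before the coalition is first met,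
      and \<open>v\<close> is the member that cannot gain. If no choice meets the coalition,
      \<open>zs\<close> is all of \<open>es\<close> and any member will do.\<close>
    obtain ys zs v where es: "es = ys @ zs" and v: "v \<in> C" and zs: "C \<inter> \<Union>(set zs) = {}"
      and bound: "\<And>u. {v, u} \<in> edges G \<Longrightarrow> u \<notin> \<Union>(set zs) \<Longrightarrow>
        reward G {v, u} (budget G v) (budget G u) \<le> utility G ?s v"
    proof (cases "\<exists>e\<in>set es. C \<inter> e \<noteq> {}")
      case True
      then obtain ys e zs where es: "es = ys @ e # zs" and e: "C \<inter> e \<noteq> {}"
        and zs: "\<forall>a\<in>set zs. \<not> C \<inter> a \<noteq> {}"
        \<comment> \<open>The earliest choice is the last list entry, since recent choices stand in
          front.\<close>
        using split_list_last_prop[of es "\<lambda>e. C \<inter> e \<noteq> {}"] by blast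
      from e obtain v where v: "v \<in> C" "v \<in> e" by blast
      show thesis
      proof (rule that[of "ys @ [e]" zs v])
        show "C \<inter> \<Union>(set zs) = {}" using zs by blast
        show "reward G {v, u} (budget G v) (budget G u) \<le> utility G ?s v"
          if "{v, u} \<in> edges G" "u \<notin> \<Union>(set zs)" for u
          using greedy_utility_ge[of ys e zs v u] that v zs greedy unfolding es by blast
      qed (use es v in auto)
    next
      case False
      from C obtain v where v: "v \<in> C" by blast
      show thesis
      proof (rule that[of "[]" es v])
        show "C \<inter> \<Union>(set es) = {}" using False by blast
        show "reward G {v, u} (budget G v) (budget G u) \<le> utility G ?s v"
          if "{v, u} \<in> edges G" "u \<notin> \<Union>(set es)" for u
          using greedy_exhausted[OF greedy len that(1)] that(2) v False utility_nonneg[OF st, of v]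
          by fastforce
      qed (use v in auto)
    qed
    have "utility G (override_on ?s s' C) v \<le> utility G ?s v"
    proof (rule utility_le)
      show "game_state G (override_on ?s s' C)"
        using st dev by (intro game_state_override) (auto simp: coalitional_deviation_def)
      show "v \<in> nodes G" using v C by blast
      show "0 \<le> utility G ?s v" by (rule utility_nonneg[OF st])
      fix u assume e: "{v, u} \<in> edges G"
      show "override_on ?s s' C u {v, u} = 0 \<or>
        reward G {v, u} (budget G v) (budget G u) \<le> utility G ?s v"
      proof (cases "u \<in> \<Union>(set zs)")
        case True
        \<comment> \<open>Such a \<open>u\<close> keeps its allotment, which has nothing on an edge
          with the then unserved \<open>v\<close>.\<close>
        then have "u \<notin> C" "v \<notin> \<Union>(set zs)" using zs v by blast+
        then show ?thesis using allot_earlier[OF True, of v] es by auto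
      next
        case False
        then show ?thesis using bound e by blast
      qed
    qed
    moreover have "utility G (override_on ?s s' C) v > utility G ?s v"
      using dev v by (auto simp: coalitional_deviation_def)
    ultimately show False by simp
  qed
  then show ?thesis using st by (auto simp: strong_equilibrium_def)
qed

end

section \<open>Running programs\<close>

text \<open>An upper bound on the time instead of the exact time, so that runs through different
  branches share one bound.\<close>

definition runs :: "value_oracle \<Rightarrow> com \<Rightarrow> nat \<Rightarrow> store \<Rightarrow> store \<Rightarrow> bool" where
  "runs q c a M M' \<longleftrightarrow> (\<exists>t\<le>a. exec q c M t M')"

lemma runsI: "exec q c M t M' \<Longrightarrow> t \<le> a \<Longrightarrow> runs q c a M M'"
  by (auto simp: runs_def)

lemma runs_Seq: "runs q c a M M' \<Longrightarrow> runs q d b M' M'' \<Longrightarrow> runs q (Seq c d) (a + b) M M''"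
  unfolding runs_def by (meson add_mono exec.Seq)

text \<open>The invariant is indexed by the number of completed iterations. The extra 1 in the
  number of iterations pays for the final, failing test of the guard.\<close>

lemma runs_While_count:
  assumes step: "\<And>k M. k < N \<Longrightarrow> I k M \<Longrightarrow> \<exists>M'. runs q c a M M' \<and> I (Suc k) M'"
    and guard: "\<And>k M. k \<le> N \<Longrightarrow> I k M \<Longrightarrow> bval q b M \<longleftrightarrow> k < N"
    and "I j M" "j \<le> N"
  shows "\<exists>M'. runs q (While b c) ((N - j + 1) * (1 + bcost b + a)) M M' \<and> I N M'"
  using assms(3,4)
proof (induction "N - j" arbitrary: j M)
  case 0
  then have "\<not> bval q b M" "j = N" using guard[of j M] by auto
  then show ?case using 0 by (intro exI[of _ M] conjI runsI[OF exec.WhileFalse]) auto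
next
  case (Suc i)
  then have j: "j < N" by auto
  from step[OF j Suc.prems(1)] obtain M1 t where
    t: "t \<le> a" "exec q c M t M1" and I1: "I (Suc j) M1" by (auto simp: runs_def)
  have "\<exists>M'. runs q (While b c) ((N - Suc j + 1) * (1 + bcost b + a)) M1 M' \<and> I N M'"
    using Suc.hyps j I1 by (intro Suc.hyps(1)) auto
  then obtain M2 t2 where t2: "t2 \<le> (N - Suc j + 1) * (1 + bcost b + a)"
    "exec q (While b c) M1 t2 M2" and I2: "I N M2" by (auto simp: runs_def)
  have "exec q (While b c) M (1 + bcost b + t + t2) M2"
    using guard[of j M] Suc.prems j t(2) t2(2) by (intro exec.WhileTrue) auto
  moreover have "1 + bcost b + t + t2 \<le> (N - j + 1) * (1 + bcost b + a)"
  proof -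
    have "N - j + 1 = Suc (N - Suc j + 1)" using j by simp
    then show ?thesis using t(1) t2(1) by simp
  qed
  ultimately show ?case using I2 by (blast intro: runsI)
qed

section \<open>Symbolic execution of loop-free programs\<close>

primrec loop_free :: "com \<Rightarrow> bool" where
  "loop_free Skip \<longleftrightarrow> True"
| "loop_free (SetN i a) \<longleftrightarrow> True"
| "loop_free (SetR i a) \<longleftrightarrow> True"
| "loop_free (StoreN a b) \<longleftrightarrow> True"
| "loop_free (StoreR a b) \<longleftrightarrow> True"
| "loop_free (Seq c d) \<longleftrightarrow> loop_free c \<and> loop_free d"
| "loop_free (Cond b c d) \<longleftrightarrow> loop_free c \<and> loop_free d"
| "loop_free (While b c) \<longleftrightarrow> False"

text \<open>\<open>result\<close> and \<open>cost_bound\<close> are meaningful for loop-free programs only.\<close>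

primrec result :: "value_oracle \<Rightarrow> com \<Rightarrow> store \<Rightarrow> store" where
  "result q Skip M = M"
| "result q (SetN i a) M = M\<lparr>nreg := (nreg M)(i := nval a M)\<rparr>"
| "result q (SetR i a) M = M\<lparr>rreg := (rreg M)(i := rval q a M)\<rparr>"
| "result q (StoreN a b) M = M\<lparr>nmem := (nmem M)(nval a M := nval b M)\<rparr>"
| "result q (StoreR a b) M = M\<lparr>rmem := (rmem M)(nval a M := rval q b M)\<rparr>"
| "result q (Seq c d) M = result q d (result q c M)"
| "result q (Cond b c d) M = (if bval q b M then result q c M else result q d M)"
| "result q (While b c) M = M"

primrec cost_bound :: "com \<Rightarrow> nat" where
  "cost_bound Skip = 1"
| "cost_bound (SetN i a) = 1 + ncost a"
| "cost_bound (SetR i a) = 1 + rcost a"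
| "cost_bound (StoreN a b) = 1 + ncost a + ncost b"
| "cost_bound (StoreR a b) = 1 + ncost a + rcost b"
| "cost_bound (Seq c d) = cost_bound c + cost_bound d"
| "cost_bound (Cond b c d) = 1 + bcost b + cost_bound c + cost_bound d"
| "cost_bound (While b c) = 0"

text \<open>A conditional is charged for both branches, which makes the bound independent of the
  store.\<close>

lemma runs_loop_free: "loop_free c \<Longrightarrow> runs q c (cost_bound c) M (result q c M)"
proof (induction c arbitrary: M)
  case (Seq c d)
  then show ?case by (auto intro: runs_Seq)
next
  case (Cond b c d)
  show ?case
  proof (cases "bval q b M")
    case True
    from Cond obtain t where "t \<le> cost_bound c" "exec q c M t (result q c M)"
      by (auto simp: runs_def)
    with True show ?thesis by (auto intro!: runsI[OF exec.CondTrue])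
  next
    case False
    from Cond obtain t where "t \<le> cost_bound d" "exec q d M t (result q d M)"
      by (auto simp: runs_def)
    with False show ?thesis by (auto intro!: runsI[OF exec.CondFalse])
  qed
qed (auto intro: runsI exec.intros simp del: One_nat_def add_Suc plus_1_eq_Suc)

section \<open>The greedy program\<close>

text \<open>Registers: 2 counts the rounds, 3 scans the edges, 4 holds the best edge seen and real
  register 0 its value. The budget cells hold the residual budgets.\<close>

definition cell :: "nat \<Rightarrow> nat \<Rightarrow> nexp" where
  "cell i c = NAdd (NAdd (NReg i) (NReg i)) (NConst c)"

lemma nval_cell: "nval (cell i c) M = 2 * nreg M i + c"
  by (simp add: cell_def)

definition edge_value :: "nat \<Rightarrow> rexp" where
  "edge_value i = Query (NReg i) (RMem (NMem (cell i 0))) (RMem (NMem (cell i 1)))"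

text \<open>Edge 0 is the first candidate. It exists, since the outer loop has no rounds when there
  are no edges.\<close>

definition start_scan :: com where
  "start_scan = Seq (SetN 3 (NConst 0)) (Seq (SetN 4 (NConst 0)) (SetR 0 (edge_value 4)))"

definition scan_edge :: com where
  "scan_edge = Seq
     (Cond (RLess (RReg 0) (edge_value 3)) (Seq (SetR 0 (edge_value 3)) (SetN 4 (NReg 3))) Skip)
     (SetN 3 (NAdd (NReg 3) (NConst 1)))"

text \<open>The residual budget is added to the output cell, as in \<open>allot\<close>: overwriting
  would erase the contribution when an edge is chosen again.\<close>

definition pay :: "nat \<Rightarrow> com" where
  "pay c = Seq
     (StoreR (NAdd (NReg 0) (cell 4 c))
       (RAdd (RMem (NAdd (NReg 0) (cell 4 c))) (RMem (NMem (cell 4 c)))))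
     (StoreR (NMem (cell 4 c)) (OfNat (NConst 0)))"

lemma result_pay:
  "result q (pay c) M = (let a = 2 * nreg M 4 + c in
     M\<lparr>rmem := (rmem M)(nreg M 0 + a := rmem M (nreg M 0 + a) + rmem M (nmem M a), nmem M a := 0)\<rparr>)"
  by (simp add: pay_def nval_cell Let_def)

definition finish_round :: com where
  "finish_round = Seq (pay 0) (Seq (pay 1) (SetN 2 (NAdd (NReg 2) (NConst 1))))"

definition scan :: com where
  "scan = While (NLess (NReg 3) (NReg 1)) scan_edge"

definition greedy_round :: com where
  "greedy_round = Seq start_scan (Seq scan finish_round)"

definition greedy_program :: com where
  "greedy_program = While (NLess (NReg 2) (NReg 1)) greedy_round"

definition scan_bound :: nat where
  "scan_bound = 1 + bcost (NLess (NReg 3) (NReg 1)) + cost_bound scan_edge"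

text \<open>Chosen so that a round, including the guard of the outer loop, costs at most
  \<open>time_factor\<close> times the number of edges plus 1.\<close>

definition time_factor :: nat where
  "time_factor = 1 + bcost (NLess (NReg 2) (NReg 1)) +
     (cost_bound start_scan + scan_bound + cost_bound finish_round)"

locale presented_game = class_C0_game +
  fixes vs :: "'a list" and ps :: "(nat \<times> nat) list"
  assumes presents: "presents vs ps G"
begin

abbreviation "oracle \<equiv> reward_oracle vs ps G"

abbreviation "fst_node k \<equiv> vs ! fst (ps ! k)"
abbreviation "snd_node k \<equiv> vs ! snd (ps ! k)"

definition edge_reward :: "'a set list \<Rightarrow> nat \<Rightarrow> real" where
  "edge_reward es k =
     reward G (edge_at vs ps k) (residual G es (fst_node k)) (residual G es (snd_node k))"

text \<open>The invariant of the outer loop. It leaves the working registers of the scan free and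
  therefore persists while edges are scanned.\<close>

definition represents :: "'a set list \<Rightarrow> store \<Rightarrow> bool" where
  "represents es M \<longleftrightarrow>
     nreg M 0 = length vs \<and> nreg M 1 = length ps \<and> nreg M 2 = length es \<and>
     nmem M = nmem (input_store vs ps G) \<and>
     (\<forall>i<length vs. rmem M i = residual G es (vs ! i)) \<and> outputs vs ps M (allot G es)"

text \<open>The invariant of the inner loop; for \<open>k = length ps\<close> the edge in register 4
  is a greedy choice.\<close>

definition scanned :: "'a set list \<Rightarrow> nat \<Rightarrow> store \<Rightarrow> bool" where
  "scanned es k M \<longleftrightarrow> represents es M \<and> nreg M 3 = k \<and> nreg M 4 < length ps \<and>
     rreg M 0 = edge_reward es (nreg M 4) \<and> (\<forall>i<k. edge_reward es i \<le> rreg M 0)"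

lemma ends_less: "k < length ps \<Longrightarrow> fst (ps ! k) < length vs \<and> snd (ps ! k) < length vs"
  using presents by (fastforce simp: presents_def dest: nth_mem)

lemma nth_eq: "i < length vs \<Longrightarrow> j < length vs \<Longrightarrow> vs ! i = vs ! j \<longleftrightarrow> i = j"
  using presents by (simp add: presents_def nth_eq_iff_index_eq)

lemma edge_at_edge: "k < length ps \<Longrightarrow> edge_at vs ps k \<in> edges G"
  using presents by (auto simp: presents_def dest: bij_betwE)

lemma edge_at_eq:
  "k < length ps \<Longrightarrow> l < length ps \<Longrightarrow> edge_at vs ps k = edge_at vs ps l \<longleftrightarrow> k = l"
  using presents by (auto simp: presents_def bij_betw_def inj_on_def)

lemma edge_obtain:
  assumes "e \<in> edges G" obtains k where "k < length ps" "e = edge_at vs ps k"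
proof -
  have "e \<in> edge_at vs ps ` {..<length ps}"
    using assms presents by (simp add: presents_def bij_betw_def)
  with that show thesis by auto
qed

lemma length_ps: "length ps = card (edges G)"
  using presents bij_betw_same_card by (fastforce simp: presents_def)

lemma ends_nodes:
  assumes "k < length ps"
  shows "fst_node k \<in> nodes G" "snd_node k \<in> nodes G" "fst (ps ! k) \<noteq> snd (ps ! k)"
  using edge_nodes[of "fst_node k" "snd_node k"] edge_at_edge[OF assms]
  by (auto simp: edge_at_def)

lemma nmem_input:
  assumes "k < length ps"
  shows "nmem (input_store vs ps G) (2 * k) = fst (ps ! k)"
    and "nmem (input_store vs ps G) (Suc (2 * k)) = snd (ps ! k)"
proof -
  have "Suc (2 * k) < 2 * length ps" "Suc (2 * k) div 2 = k"
    using assms by linarith+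
  then show "nmem (input_store vs ps G) (2 * k) = fst (ps ! k)"
    and "nmem (input_store vs ps G) (Suc (2 * k)) = snd (ps ! k)"
    by (auto simp: input_store_def)
qed

text \<open>The oracle answers 0 to negative arguments; residual budgets are nonnegative, so the
  true reward is returned.\<close>

lemma edge_value:
  assumes "represents es M" "nreg M i < length ps"
  shows "rval oracle (edge_value i) M = edge_reward es (nreg M i)"
  using assms ends_less[OF assms(2)] ends_nodes[OF assms(2)] residual_nonneg
  by (simp add: edge_value_def nval_cell represents_def nmem_input reward_oracle_def edge_reward_def)

lemma represents_cong:
  assumes "represents es M" "nreg M' 0 = nreg M 0" "nreg M' 1 = nreg M 1" "nreg M' 2 = nreg M 2"
    "nmem M' = nmem M" "rmem M' = rmem M"
  shows "represents es M'"
  using assms by (simp add: represents_def outputs_def)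

lemma start_scan:
  assumes "represents es M" "0 < length ps"
  shows "scanned es 0 (result oracle start_scan M)"
proof -
  \<comment> \<open>The store in which the query of \<open>start_scan\<close> is evaluated.\<close>
  let ?M = "M\<lparr>nreg := (nreg M)(3 := 0, 4 := 0)\<rparr>"
  have "represents es ?M" using assms(1) by (rule represents_cong) auto
  then have "rval oracle (edge_value 4) ?M = edge_reward es 0"
    using edge_value[of es ?M 4] assms(2) by simp
  moreover have "represents es (result oracle start_scan M)"
    using assms(1) by (rule represents_cong) (auto simp: start_scan_def)
  ultimately show ?thesis using assms(2) by (simp add: scanned_def start_scan_def)
qed

lemma scan_edge:
  assumes "scanned es k M" "k < length ps"
  shows "scanned es (Suc k) (result oracle scan_edge M)"
proof -
  have rep: "represents es M" using assms(1) by (simp add: scanned_def)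
  have v: "rval oracle (edge_value 3) M = edge_reward es k"
    using edge_value[OF rep, of 3] assms by (simp add: scanned_def)
  have "represents es (result oracle scan_edge M)"
    using rep by (rule represents_cong) (auto simp: scan_edge_def)
  then show ?thesis
    using assms v by (auto simp: scanned_def scan_edge_def less_Suc_eq)
qed

text \<open>The scan evaluates each edge with its ends in the order of the list, whereas
  \<open>greedy\<close> refers to both orders; symmetry of the rewards (\<open>pays\<close>) closes
  the gap.\<close>

lemma greedy_Cons:
  assumes "scanned es (length ps) M" "greedy G es"
  shows "greedy G (edge_at vs ps (nreg M 4) # es)"
proof -
  let ?k = "nreg M 4" and ?r = "residual G es"
  have k: "?k < length ps" using assms(1) by (simp add: scanned_def)
  have pays: "reward G {u, v} (?r u) (?r v) = edge_reward es l"
    if l: "l < length ps" and "edge_at vs ps l = {u, v}" for l u v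
  proof -
    have "{u, v} \<in> edges G" using that edge_at_edge by metis
    then have c: "reward G {u, v} \<in> class_C0" "u \<in> nodes G" "v \<in> nodes G"
      using rewards edge_nodes by auto
    have "u = fst_node l \<and> v = snd_node l \<or> u = snd_node l \<and> v = fst_node l"
      using that(2) by (auto simp: edge_at_def doubleton_eq_iff)
    then show ?thesis
      using that(2) class_C0_symmetric[OF c(1) residual_nonneg[OF c(2)] residual_nonneg[OF c(3)]]
      by (auto simp: edge_reward_def)
  qed
  have "reward G {u, v} (?r u) (?r v) \<le> reward G (edge_at vs ps ?k) (?r x) (?r y)"
    if xy: "edge_at vs ps ?k = {x, y}" and uv: "{u, v} \<in> edges G" for u v x y
  proof -
    from uv obtain l where l: "l < length ps" "{u, v} = edge_at vs ps l" by (rule edge_obtain)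
    have "reward G {u, v} (?r u) (?r v) = edge_reward es l" using pays l by metis
    also have "\<dots> \<le> edge_reward es ?k" using assms(1) l(1) by (auto simp: scanned_def)
    also have "\<dots> = reward G (edge_at vs ps ?k) (?r x) (?r y)" using pays k xy by simp
    finally show ?thesis .
  qed
  then show ?thesis using assms(2) k edge_at_edge by simp
qed

lemma finish_round:
  assumes "scanned es (length ps) M"
  shows "represents (edge_at vs ps (nreg M 4) # es) (result oracle finish_round M)"
proof -
  define k where "k = nreg M 4"
  have k: "k < length ps" and rep: "represents es M"
    using assms by (auto simp: scanned_def k_def)
  let ?i = "fst (ps ! k)" and ?j = "snd (ps ! k)" and ?n = "length vs"
  have ij: "?i < ?n" "?j < ?n" "?i \<noteq> ?j" using ends_less[OF k] ends_nodes[OF k] by auto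
  let ?M = "result oracle finish_round M"
  have regs: "nreg ?M = (nreg M)(2 := Suc (length es))" "nmem ?M = nmem M"
    using rep by (simp_all add: finish_round_def result_pay Let_def represents_def)
  have mem: "rmem ?M = (rmem M)
    (?n + 2 * k := rmem M (?n + 2 * k) + rmem M ?i, ?i := 0,
     ?n + 2 * k + 1 := rmem M (?n + 2 * k + 1) + rmem M ?j, ?j := 0)"
  proof -
    have M: "nreg M 0 = ?n" "nreg M 4 = k" "nmem M (2 * k) = ?i" "nmem M (Suc (2 * k)) = ?j"
      using rep nmem_input[OF k] by (simp_all add: represents_def k_def)
    \<comment> \<open>The first payment alters neither the budget nor the output cell that the
      second one reads.\<close>
    have "?j \<noteq> ?n + 2 * k" "?j \<noteq> ?i" "Suc (?n + 2 * k) \<noteq> ?i" using ij by auto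
    then show ?thesis by (simp add: finish_round_def result_pay Let_def M)
  qed
  have res: "rmem ?M a = residual G (edge_at vs ps k # es) (vs ! a)" if "a < ?n" for a
  proof -
    have "rmem M a = residual G es (vs ! a)" using rep that by (simp add: represents_def)
    then show ?thesis
      using that ij nth_eq[of a ?i] nth_eq[of a ?j] by (auto simp: mem residual_def edge_at_def)
  qed
  have ri: "rmem M ?i = residual G es (vs ! ?i)" and rj: "rmem M ?j = residual G es (vs ! ?j)"
    using rep ij by (auto simp: represents_def)
  have "outputs vs ps ?M (allot G (edge_at vs ps k # es))"
    unfolding outputs_def
  proof (intro allI impI)
    fix l assume l: "l < length ps"
    have old: "allot G es (fst_node l) (edge_at vs ps l) = rmem M (?n + 2 * l)"
      "allot G es (snd_node l) (edge_at vs ps l) = rmem M (?n + 2 * l + 1)"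
      using rep l by (auto simp: represents_def outputs_def)
    \<comment> \<open>Parity separates the output cells of first ends from those of second
      ends.\<close>
    have "2 * l \<noteq> 2 * k + 1" "2 * l + 1 \<noteq> 2 * k" by presburger+
    then have "rmem ?M (?n + 2 * l) = rmem M (?n + 2 * l) + (if l = k then rmem M ?i else 0)"
      "rmem ?M (?n + 2 * l + 1) = rmem M (?n + 2 * l + 1) + (if l = k then rmem M ?j else 0)"
      using ij by (auto simp: mem)
    moreover have "fst_node k \<in> edge_at vs ps k" "snd_node k \<in> edge_at vs ps k"
      by (auto simp: edge_at_def)
    ultimately show "allot G (edge_at vs ps k # es) (fst_node l) (edge_at vs ps l)
          = rmem ?M (?n + 2 * l) \<and>
        allot G (edge_at vs ps k # es) (snd_node l) (edge_at vs ps l) = rmem ?M (?n + 2 * l + 1)"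
      using old ri rj edge_at_eq[OF l k] by auto
  qed
  then show ?thesis
    using res rep by (simp add: represents_def regs flip: k_def)
qed

lemma greedy_round:
  assumes "represents es M" "greedy G es" "length es < length ps"
  shows "\<exists>e M'. runs oracle greedy_round
      (cost_bound start_scan + ((length ps + 1) * scan_bound + cost_bound finish_round)) M M' \<and>
    represents (e # es) M' \<and> greedy G (e # es)"
proof -
  \<comment> \<open>The difference with 0 matches the bound of \<open>runs_While_count\<close>
    started at \<open>j = 0\<close>.\<close>
  have "\<exists>M'. runs oracle scan ((length ps - 0 + 1) * scan_bound) (result oracle start_scan M) M' \<and>
      scanned es (length ps) M'"
    unfolding scan_def scan_bound_def
  proof (rule runs_While_count)
    show "scanned es 0 (result oracle start_scan M)"
      using assms by (intro start_scan) auto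
    show "\<exists>M'. runs oracle scan_edge (cost_bound scan_edge) M M' \<and> scanned es (Suc k) M'"
      if "k < length ps" "scanned es k M" for k M
    proof -
      have "loop_free scan_edge" by (simp add: scan_edge_def)
      then show ?thesis using that scan_edge runs_loop_free by blast
    qed
  qed (auto simp: scanned_def represents_def)
  then obtain M' where M': "runs oracle scan ((length ps + 1) * scan_bound)
      (result oracle start_scan M) M'" "scanned es (length ps) M'" by auto
  have "runs oracle greedy_round
      (cost_bound start_scan + ((length ps + 1) * scan_bound + cost_bound finish_round)) M
      (result oracle finish_round M')"
    unfolding greedy_round_def
    by (rule runs_Seq[OF runs_loop_free runs_Seq[OF M'(1) runs_loop_free]])
       (simp_all add: start_scan_def finish_round_def pay_def)
  then show ?thesis using finish_round[OF M'(2)] greedy_Cons[OF M'(2) assms(2)] by blast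
qed

lemma represents_input: "represents [] (input_store vs ps G)"
  using presents by (auto simp: represents_def outputs_def input_store_def residual_def)

theorem greedy_program:
  "\<exists>t M s. exec oracle greedy_program (input_store vs ps G) t M \<and>
     t \<le> time_factor * (length vs + length ps + 1) ^ 2 \<and>
     outputs vs ps M s \<and> strong_equilibrium G s"
proof -
  let ?a = "cost_bound start_scan + ((length ps + 1) * scan_bound + cost_bound finish_round)"
  let ?b = "bcost (NLess (NReg 2) (NReg 1))"
  \<comment> \<open>The choices made so far are not stored by the machine and are hidden behind the
    existential quantifier; only their number is counted.\<close>
  let ?I = "\<lambda>t M. \<exists>es. represents es M \<and> greedy G es \<and> length es = t"
  have "\<exists>M. runs oracle greedy_program ((length ps - 0 + 1) * (1 + ?b + ?a))
      (input_store vs ps G) M \<and> ?I (length ps) M"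
    unfolding greedy_program_def
  proof (rule runs_While_count)
    show "?I 0 (input_store vs ps G)"
      using represents_input by (intro exI[of _ "[]"]) simp
    show "\<exists>M'. runs oracle greedy_round ?a M M' \<and> ?I (Suc k) M'" if "k < length ps" "?I k M" for k M
    proof -
      from that(2) obtain es where "represents es M" "greedy G es" "length es = k" by blast
      with greedy_round[of es M] that(1) obtain e M' where "runs oracle greedy_round ?a M M'"
        "represents (e # es) M'" "greedy G (e # es)" by blast
      with \<open>length es = k\<close> show ?thesis by (metis length_Cons)
    qed
  qed (auto simp: represents_def)
  then obtain t M es where t: "t \<le> (length ps + 1) * (1 + ?b + ?a)"
    and M: "exec oracle greedy_program (input_store vs ps G) t M"
    and es: "represents es M" "greedy G es" "length es = length ps"
    by (auto simp: runs_def)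
  let ?l = "length ps + 1" and ?N = "length vs + length ps + 1"
  have "1 + ?b + ?a \<le> time_factor * ?l"
    by (simp add: time_factor_def algebra_simps)
  then have "t \<le> ?l * (time_factor * ?l)"
    using t by (meson mult_le_mono2 order_trans)
  also have "\<dots> = time_factor * ?l ^ 2" by (simp only: power2_eq_square ac_simps)
  also have "\<dots> \<le> time_factor * ?N ^ 2" by (intro mult_le_mono2 power_mono) auto
  finally have "t \<le> time_factor * ?N ^ 2" .
  moreover have "outputs vs ps M (allot G es)" using es(1) by (simp add: represents_def)
  moreover have "strong_equilibrium G (allot G es)"
    using es greedy_strong_equilibrium length_ps by simp
  ultimately show ?thesis using M by blast
qed

end

text \<open>Existence of an equilibrium is read off from the algorithm, which needs some
  presentation of the game: list the nodes and the edges and pick positions for the ends of each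
  edge.\<close>

lemma presentation_exists:
  assumes "contribution_game G"
  shows "\<exists>vs ps. presents vs ps G"
proof -
  have fin: "finite (nodes G)" and sub: "\<forall>e\<in>edges G. e \<subseteq> nodes G \<and> card e = 2"
    using assms by (auto simp: contribution_game_def)
  obtain vs where vs: "set vs = nodes G" "distinct vs" using finite_distinct_list[OF fin] by blast
  have "edges G \<subseteq> Pow (nodes G)" using sub by blast
  then have "finite (edges G)" using fin finite_subset by blast
  then obtain es where es: "set es = edges G" "distinct es" using finite_distinct_list by blast
  have "\<forall>e\<in>edges G. \<exists>p. fst p < length vs \<and> snd p < length vs \<and> {vs ! fst p, vs ! snd p} = e"
  proof
    fix e assume "e \<in> edges G"
    then obtain x y where e: "e = {x, y}" "x \<in> set vs" "y \<in> set vs"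
      using sub vs by (fastforce simp: card_2_iff)
    then obtain i j where "i < length vs" "vs ! i = x" "j < length vs" "vs ! j = y"
      by (auto simp: in_set_conv_nth)
    then show "\<exists>p. fst p < length vs \<and> snd p < length vs \<and> {vs ! fst p, vs ! snd p} = e"
      using e by (intro exI[of _ "(i, j)"]) simp
  qed
  from bchoice[OF this] obtain p where p: "\<forall>e\<in>edges G. fst (p e) < length vs \<and> snd (p e) < length vs \<and>
      {vs ! fst (p e), vs ! snd (p e)} = e"
    by blast
  have at: "edge_at vs (map p es) k = es ! k" if "k < length es" for k
  proof -
    have "es ! k \<in> edges G" using that es nth_mem by blast
    then show ?thesis using p that by (simp add: edge_at_def)
  qed
  have "bij_betw (edge_at vs (map p es)) {..<length (map p es)} (edges G)"
    using bij_betw_nth[OF es(2) refl es(1)[symmetric]] at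
    bij_betw_cong[of "{..<length es}" "edge_at vs (map p es)" "(!) es" "edges G"]
    by simp
  moreover have "\<forall>(i, j)\<in>set (map p es). i < length vs \<and> j < length vs"
    using p es by (simp add: case_prod_beta)
  ultimately have "presents vs (map p es) G" using vs by (simp add: presents_def)
  then show ?thesis by blast
qed

theorem corollary2p6:
  shows "(\<forall>G :: 'v game.
            contribution_game G \<and> (\<forall>e\<in>edges G. reward G e \<in> class_C0) \<longrightarrow>
            (\<exists>s. strong_equilibrium G s)) \<and>
         (\<exists>alg c d. \<forall>(G :: 'v game) vs ps.
            contribution_game G \<and> (\<forall>e\<in>edges G. reward G e \<in> class_C0) \<and> presents vs ps G \<longrightarrow>
            (\<exists>t M s. exec (reward_oracle vs ps G) alg (input_store vs ps G) t M \<and>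
                     t \<le> c * (length vs + length ps + 1) ^ d \<and>
                     outputs vs ps M s \<and> strong_equilibrium G s))"
proof -
  \<comment> \<open>Neither \<open>greedy_program\<close> nor \<open>time_factor\<close> depends on
    the game, so they can serve as witnesses for all games at once.\<close>
  have run: "\<exists>t M s. exec (reward_oracle vs ps G) greedy_program (input_store vs ps G) t M \<and>
      t \<le> time_factor * (length vs + length ps + 1) ^ 2 \<and>
      outputs vs ps M s \<and> strong_equilibrium G s"
    if "contribution_game G \<and> (\<forall>e\<in>edges G. reward G e \<in> class_C0) \<and> presents vs ps G"
    for G :: "'v game" and vs ps
  proof -
    interpret presented_game G vs ps by unfold_locales (use that in auto)
    show ?thesis by (rule greedy_program)
  qed
  show ?thesis
  proof (intro conjI)
    show "\<forall>G :: 'v game.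
        contribution_game G \<and> (\<forall>e\<in>edges G. reward G e \<in> class_C0) \<longrightarrow> (\<exists>s. strong_equilibrium G s)"
      using presentation_exists run by metis
    show "\<exists>alg c d. \<forall>(G :: 'v game) vs ps.
        contribution_game G \<and> (\<forall>e\<in>edges G. reward G e \<in> class_C0) \<and> presents vs ps G \<longrightarrow>
        (\<exists>t M s. exec (reward_oracle vs ps G) alg (input_store vs ps G) t M \<and>
                 t \<le> c * (length vs + length ps + 1) ^ d \<and>
                 outputs vs ps M s \<and> strong_equilibrium G s)"
      using run by blast
  qed
qed

end
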